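(* Let $f>0$, $c>0$, and let $\mathbf{X}^1,\mathbf{X}^2,\mathbf{X}^3\in\mathbb{R}^3$ be three non-aligned points with first coordinate $0$, $\mathbf{X}^i=(0,X^i_2,X^i_3)^\top$, with $X^i_3>f$ for $i=1,2,3$. Suppose that $$\frac{\Vert \mathbf{X}^{i}\times \mathbf{X}^{j}\Vert}{\Vert \mathbf{X}^{i}-\mathbf{X}^{j}\Vert}>f\qquad\text{for all } i,j\in\{1,2,3\},\ i\neq j,$$ where $\times$ is the cross product and $\Vert\cdot\Vert$ the Euclidean norm. If the f-number $N(\mathbf{a},\theta)$ reaches its minimum over all admissible pairs at an admissible pair $(\mathbf{a},\theta)$, then all three points are in contact with the limiting planes: for every $i\in\{1,2,3\}$, $$(\mathbf{X}^{i}-\mathbf{W}(\theta))^\top\mathbf{n^1}=0\quad\text{or}\quad (\mathbf{X}^{i}-\mathbf{W}(\theta))^\top\mathbf{n^2}=0.$$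
   Context: Setting: a thin lens of focal length $f>0$ with optical center at the origin of $\mathbb{R}^3$, a circle of confusion of diameter $c>0$, a sensor plane with normal $(0,0,1)^\top$, and a lens plane through the origin tilted by an angle $\theta\in(-\pi/2,\pi/2)$, $\theta\neq 0$. The depth of field problem is treated in two dimensions: all object points have first coordinate $0$. For such $\theta$ and for $\mathbf{a}=(a_1,a_2)\in\mathbb{R}^2$ define $$\mathbf{n^L}=(0,-\sin\theta,\cos\theta)^\top,\quad \mathbf{W}(\theta)=\left(0,-\tfrac{f}{\sin\theta},0\right)^\top,\quad \mathbf{n^1}=(0,-1,a_1)^\top,\quad \mathbf{n^2}=(0,-1,a_2)^\top.$$ The limiting planes of the depth of field region are, for $k=1,2$, $$\mathrm{SFP}_k=\{\mathbf{X}\in\mathbb{R}^3:\ (\mathbf{X}-\mathbf{W}(\theta))^\top\mathbf{n}^k=0\}.$$ The f-number is $$N(\mathbf{a},\theta)=\frac{f}{c}\left|\frac{(a_1-a_2)\sin\theta}{2\cos\theta-(a_1+a_2)\sin\theta}\right|,$$ considered where the denominator is nonzero. Given the points $\mathbf{X}^1,\mathbf{X}^2,\mathbf{X}^3$, a pair $(\mathbf{a},\theta)$ (with $\theta\in(-\pi/2,\pi/2)\setminus\{0\}$, $\mathbf{a}\in\mathbb{R}^2$ and $2\cos\theta-(a_1+a_2)\sin\theta\neq0$) is called admissible if for all $i=1,2,3$: $$(\mathbf{X}^i-\mathbf{W}(\theta))^\top\mathbf{n^1}\ge 0,\qquad (\mathbf{X}^i-\mathbf{W}(\theta))^\top\mathbf{n^2}\le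 0,\qquad (\mathbf{X}^i)^\top\mathbf{n^L}\ge f.$$ The first two conditions say that the points lie between the two limiting planes; the third says that they are in front of the front focal plane $\{\mathbf{X}:\mathbf{X}^\top\mathbf{n^L}=f\}$. *)

theory Defs
  imports "HOL-Analysis.Analysis"
begin

definition lens_normal :: "real \<Rightarrow> real^3" where
  "lens_normal \<theta> = vector [0, - sin \<theta>, cos \<theta>]"

text \<open>Point through which both limiting planes pass, for focal length \<open>f\<close> and lens tilt \<open>\<theta>\<close>.\<close>

definition hinge_point :: "real \<Rightarrow> real \<Rightarrow> real^3" where
  "hinge_point f \<theta> = vector [0, - (f / sin \<theta>), 0]"

definition limit_normal :: "real^2 \<Rightarrow> 2 \<Rightarrow> real^3" where
  "limit_normal a k = vector [0, - 1, a $ k]"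

text \<open>The limiting planes of the depth of field region are \<open>SFP f a \<theta> 1\<close> and \<open>SFP f a \<theta> 2\<close>.\<close>

definition SFP :: "real \<Rightarrow> real^2 \<Rightarrow> real \<Rightarrow> 2 \<Rightarrow> (real^3) set" where
  "SFP f a \<theta> k = {P. (P - hinge_point f \<theta>) \<bullet> limit_normal a k = 0}"

definition f_number :: "real \<Rightarrow> real \<Rightarrow> real^2 \<Rightarrow> real \<Rightarrow> real" where
  "f_number f c a \<theta> =
     f / c * \<bar>((a $ 1 - a $ 2) * sin \<theta>) / (2 * cos \<theta> - (a $ 1 + a $ 2) * sin \<theta>)\<bar>"

text \<open>The condition on the denominator excludes the pairs at which it vanishes in \<open>f_number\<close>,
  where division by zero would make the f-number \<open>0\<close>.\<close>

definition admissible :: "real \<Rightarrow> (3 \<Rightarrow> real^3) \<Rightarrow> real^2 \<Rightarrow> real \<Rightarrow> bool" where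
  "admissible f X a \<theta> \<longleftrightarrow>
     - (pi / 2) < \<theta> \<and> \<theta> < pi / 2 \<and> \<theta> \<noteq> 0 \<and>
     2 * cos \<theta> - (a $ 1 + a $ 2) * sin \<theta> \<noteq> 0 \<and>
     (\<forall>i. (X i - hinge_point f \<theta>) \<bullet> limit_normal a 1 \<ge> 0 \<and>
          (X i - hinge_point f \<theta>) \<bullet> limit_normal a 2 \<le> 0 \<and>
          X i \<bullet> lens_normal \<theta> \<ge> f)"

end

theory Submission
  imports Defs
begin

text \<open>
  Put \<open>p\<^sub>i(\<theta>) = (y\<^sub>i sin \<theta> + f) / z\<^sub>i\<close> for the point \<open>(0, y\<^sub>i, z\<^sub>i)\<close>, and let \<open>L \<le> U\<close> be the two numbers
  \<open>a\<^sub>k sin \<theta>\<close>. Admissibility says \<open>L \<le> p\<^sub>i \<le> U\<close> and \<open>p\<^sub>i \<le> cos \<theta>\<close>, contact says \<open>p\<^sub>i \<in> {L, U}\<close>, and the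
  f-number is a multiple of \<open>(U - L) / \<bar>2 cos \<theta> - U - L\<bar>\<close>. Since \<open>z\<^sub>i > f\<close>, small tilts give values below
  \<open>1\<close>, which forces \<open>U < cos \<theta>\<close> at a minimum; the quotient is then strictly monotone in \<open>L\<close> and \<open>U\<close>,
  hence \<open>L = min p\<^sub>i\<close> and \<open>U = max p\<^sub>i\<close>. If the third point were not in contact, the minimality would
  survive small changes of \<open>\<theta>\<close> with the same two extremal points \<open>j, k\<close>, so that
  \<open>(cos \<theta> - p\<^sub>j) / (cos \<theta> - p\<^sub>k)\<close> would have a local maximum. Up to a nonzero factor its derivative is the
  cross product of the two points minus \<open>f\<close> times one coordinate of their difference in a rotated frame,
  and by hypothesis this does not vanish.
\<close>

section \<open>Monotonicity of the f-number in the two slopes\<close>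

definition aperture_ratio :: "real \<Rightarrow> real \<Rightarrow> real \<Rightarrow> real" where
  "aperture_ratio C L U = (U - L) / \<bar>2 * C - U - L\<bar>"

lemma aperture_ratio_eq:
  assumes "L < C" "U < C"
  shows "aperture_ratio C L U = (1 - (C - U) / (C - L)) / (1 + (C - U) / (C - L))"
proof -
  have "C - L > 0" using assms by auto
  moreover have "\<bar>2 * C - U - L\<bar> = (C - U) + (C - L)" using assms by auto
  ultimately show ?thesis
    unfolding aperture_ratio_def by (simp add: divide_simps)
qed

text \<open>For \<open>2 * C - U - L > 0\<close> the denominator exceeds the numerator by
  \<open>2 * (C - U)\<close>. If instead it is negative, then \<open>L \<le> C\<close> forces
  \<open>U > C\<close> and a ratio of at least 1, so both sides fail.\<close>

lemma aperture_ratio_less_1_iff: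
  assumes "L \<le> U" "L \<le> C" "2 * C - U - L \<noteq> 0"
  shows "aperture_ratio C L U < 1 \<longleftrightarrow> U < C"
  using assms by (auto simp: aperture_ratio_def divide_less_eq abs_if)

text \<open>On positive \<open>r\<close> the map \<open>(1 - r) / (1 + r)\<close> is strictly
  decreasing, so minimizing the f-number means maximizing the quotient of the gaps to
  \<open>C\<close>.\<close>

lemma aperture_ratio_le_iff:
  assumes "L < C" "U < C" "L' < C'" "U' < C'"
  shows "aperture_ratio C L U \<le> aperture_ratio C' L' U' \<longleftrightarrow>
    (C' - U') / (C' - L') \<le> (C - U) / (C - L)"
proof -
  define r r' where "r = (C - U) / (C - L)" and "r' = (C' - U') / (C' - L')"
  have "r > 0" "r' > 0" using assms by (auto simp: r_def r'_def)
  then have "(1 - r) / (1 + r) \<le> (1 - r') / (1 + r') \<longleftrightarrow> r' \<le> r"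
    by (simp add: divide_simps) (simp add: algebra_simps)
  then show ?thesis
    using assms by (simp add: aperture_ratio_eq r_def r'_def)
qed

section \<open>Slopes of the object points and the derivative argument\<close>

text \<open>The value of \<open>sin \<phi> * a $ k\<close> for which the limiting plane passes
  through (0, y, z). The factor \<open>sin \<phi>\<close> keeps it continuous at tilt 0, where the
  hinge point escapes to infinity.\<close>

definition tilt_slope :: "real \<Rightarrow> real \<Rightarrow> real \<Rightarrow> real \<Rightarrow> real" where
  "tilt_slope f y z \<phi> = (sin \<phi> * y + f) / z"

lemma isCont_tilt_slope: "isCont (tilt_slope f y z) x"
  unfolding tilt_slope_def divide_inverse by (intro continuous_intros)

lemma cos_minus_tilt_slope:
  assumes "z \<noteq> 0"
  shows "cos \<phi> - tilt_slope f y z \<phi> = (cos \<phi> * z - sin \<phi> * y - f) / z"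
  using assms by (simp add: tilt_slope_def field_simps)

text \<open>Here \<open>w y z \<phi>\<close> is the signed distance of (0, y, z) from the front
  focal plane. A critical point of the quotient would bound the cross product by \<open>f\<close>
  times the distance of the two points.\<close>

lemma not_local_max_focal_distance_ratio:
  fixes f :: real
  defines "w \<equiv> \<lambda>y z \<phi>. cos \<phi> * z - sin \<phi> * y - f"
  assumes cross: "(y * z' - z * y')\<^sup>2 > f\<^sup>2 * ((y - y')\<^sup>2 + (z - z')\<^sup>2)"
    and pos: "w y' z' \<theta> \<noteq> 0"
  shows "\<not> (\<forall>\<^sub>F \<phi> in nhds \<theta>. w y z \<phi> / w y' z' \<phi> \<le> w y z \<theta> / w y' z' \<theta>)"
proof
  assume "\<forall>\<^sub>F \<phi> in nhds \<theta>. w y z \<phi> / w y' z' \<phi> \<le> w y z \<theta> / w y' z' \<theta>"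
  then obtain d where d: "d > 0"
    "\<forall>\<phi>. \<bar>\<theta> - \<phi>\<bar> < d \<longrightarrow> w y z \<phi> / w y' z' \<phi> \<le> w y z \<theta> / w y' z' \<theta>"
    unfolding eventually_nhds_metric dist_real_def by (auto simp: abs_minus_commute)
  let ?D = "\<lambda>y z. - sin \<theta> * z - cos \<theta> * y"
  have D: "(w y z has_real_derivative ?D y z) (at \<theta>)" for y z
    unfolding w_def by (auto intro!: derivative_eq_intros)
  have "((\<lambda>\<phi>. w y z \<phi> / w y' z' \<phi>) has_real_derivative
      (?D y z * w y' z' \<theta> - w y z \<theta> * ?D y' z') / (w y' z' \<theta> * w y' z' \<theta>)) (at \<theta>)"
    by (rule DERIV_divide[OF D D pos])
  from DERIV_local_max[OF this d] pos
  have "?D y z * w y' z' \<theta> = w y z \<theta> * ?D y' z'" by simp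
  \<comment> \<open>Keeping the factor
    \<open>(sin \<theta>)\<^sup>2 + (cos \<theta>)\<^sup>2\<close> makes this a polynomial
    identity.\<close>
  moreover have "?D y z * w y' z' \<theta> - w y z \<theta> * ?D y' z' =
      f * (sin \<theta> * (z - z') + cos \<theta> * (y - y'))
      - ((sin \<theta>)\<^sup>2 + (cos \<theta>)\<^sup>2) * (y * z' - z * y')"
    unfolding w_def by algebra
  ultimately have "y * z' - z * y' = f * (sin \<theta> * (z - z') + cos \<theta> * (y - y'))"
    by simp
  then have "(y * z' - z * y')\<^sup>2 = f\<^sup>2 * (sin \<theta> * (z - z') + cos \<theta> * (y - y'))\<^sup>2"
    by (simp add: power_mult_distrib)
  \<comment> \<open>Adding the square of the other rotated coordinate completes the squared distance
    of the points.\<close>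
  also have "\<dots> \<le> f\<^sup>2 * ((sin \<theta> * (z - z') + cos \<theta> * (y - y'))\<^sup>2
      + (cos \<theta> * (z - z') - sin \<theta> * (y - y'))\<^sup>2)"
    by (intro mult_left_mono) auto
  also have "(sin \<theta> * (z - z') + cos \<theta> * (y - y'))\<^sup>2
      + (cos \<theta> * (z - z') - sin \<theta> * (y - y'))\<^sup>2
      = ((sin \<theta>)\<^sup>2 + (cos \<theta>)\<^sup>2) * ((y - y')\<^sup>2 + (z - z')\<^sup>2)"
    by algebra
  finally show False using cross by simp
qed

section \<open>Contact at a minimum, in terms of slopes\<close>

text \<open>Taking the slopes \<open>L\<close> and \<open>U\<close> as variables in place of the
  components of \<open>a\<close> treats both signs of the tilt at once.\<close>

lemma minimal_aperture_ratio_contact: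
  fixes f \<theta> L U :: real and y z :: "3 \<Rightarrow> real"
  defines "p \<equiv> \<lambda>i. tilt_slope f (y i) (z i)"
  assumes "f > 0" and z: "\<And>i. z i > f"
    and cross: "\<And>i j. i \<noteq> j \<Longrightarrow>
      (y i * z j - z i * y j)\<^sup>2 > f\<^sup>2 * ((y i - y j)\<^sup>2 + (z i - z j)\<^sup>2)"
    and \<theta>: "- (pi / 2) < \<theta>" "\<theta> < pi / 2" "\<theta> \<noteq> 0"
    and LU: "\<And>i. L \<le> p i \<theta>" "\<And>i. p i \<theta> \<le> U" "\<And>i. p i \<theta> \<le> cos \<theta>"
    and nz: "2 * cos \<theta> - U - L \<noteq> 0"
    and min: "\<And>\<phi> L' U'. \<lbrakk>- (pi / 2) < \<phi>; \<phi> < pi / 2; \<phi> \<noteq> 0;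
        \<And>i. L' \<le> p i \<phi>; \<And>i. p i \<phi> \<le> U'; \<And>i. p i \<phi> \<le> cos \<phi>; 2 * cos \<phi> - U' - L' \<noteq> 0\<rbrakk>
      \<Longrightarrow> aperture_ratio (cos \<theta>) L U \<le> aperture_ratio (cos \<phi>) L' U'"
  shows "p i \<theta> = L \<or> p i \<theta> = U"
proof -
  have z0: "z i > 0" for i using z[of i] \<open>f > 0\<close> by simp
  have cont: "isCont (p i) x" for i x
    unfolding p_def by (rule isCont_tilt_slope)
  have "L \<le> U" "L \<le> cos \<theta>" using LU[of 1] by linarith+
  have "U < cos \<theta>"
  proof -
    \<comment> \<open>At tilt 0 the slope is \<open>f / z i < 1\<close>. Tilt 0 itself is excluded,
      so the competitor comes from a punctured neighbourhood.\<close>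
    have "\<forall>\<^sub>F \<phi> in at 0. cos \<phi> - p i \<phi> > 0" for i
    proof (rule order_tendstoD)
      show "((\<lambda>\<phi>. cos \<phi> - p i \<phi>) \<longlongrightarrow> cos 0 - p i 0) (at 0)"
        using cont[of 0 i] by (intro tendsto_intros) (simp add: isCont_def)
      show "0 < cos 0 - p i 0"
        using z[of i] z0[of i] by (simp add: p_def tilt_slope_def)
    qed
    then have "\<forall>\<^sub>F \<phi> in at 0. \<forall>i. cos \<phi> - p i \<phi> > 0"
      by (simp add: eventually_all_finite)
    moreover have "\<forall>\<^sub>F \<phi> in at 0. \<phi> \<in> {- (pi / 2)<..<pi / 2} \<and> \<phi> \<noteq> (0::real)"
      by (auto simp: eventually_at_topological intro!: exI[of _ "{- (pi / 2)<..<pi / 2}"])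
    ultimately have "\<forall>\<^sub>F \<phi> in at 0. (\<forall>i. cos \<phi> - p i \<phi> > 0) \<and>
        \<phi> \<in> {- (pi / 2)<..<pi / 2} \<and> \<phi> \<noteq> (0::real)"
      by eventually_elim auto
    then obtain \<phi> :: real where \<phi>: "\<And>i. p i \<phi> < cos \<phi>" "- (pi / 2) < \<phi>" "\<phi> < pi / 2" "\<phi> \<noteq> 0"
      using eventually_happens[of _ "at (0::real)"] trivial_limit_at by fastforce
    define L' U' where "L' = Min (range (\<lambda>i. p i \<phi>))" and "U' = Max (range (\<lambda>i. p i \<phi>))"
    have b: "L' \<le> p i \<phi>" "p i \<phi> \<le> U'" for i by (auto simp: L'_def U'_def)
    have "U' < cos \<phi>" using \<phi>(1) by (auto simp: U'_def)
    moreover have "L' \<le> U'" using b[of 1] by linarith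
    ultimately have "aperture_ratio (cos \<phi>) L' U' < 1"
      by (subst aperture_ratio_less_1_iff) auto
    moreover have "aperture_ratio (cos \<theta>) L U \<le> aperture_ratio (cos \<phi>) L' U'"
      using \<phi> b \<open>U' < cos \<phi>\<close> \<open>L' \<le> U'\<close> by (intro min) (auto intro: less_imp_le)
    ultimately have "aperture_ratio (cos \<theta>) L U < 1" by simp
    then show ?thesis
      using aperture_ratio_less_1_iff \<open>L \<le> U\<close> \<open>L \<le> cos \<theta>\<close> nz by blast
  qed
  then have "L < cos \<theta>" using \<open>L \<le> U\<close> by simp
  \<comment> \<open>\<open>U' < cos \<phi>\<close> implies the front-focal-plane condition and the
    nonzero denominator, so competitors need only enclose the slopes.\<close>
  have minU: "(cos \<phi> - U') / (cos \<phi> - L') \<le> (cos \<theta> - U) / (cos \<theta> - L)"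
    if "- (pi / 2) < \<phi>" "\<phi> < pi / 2" "\<phi> \<noteq> 0" "\<And>i. L' \<le> p i \<phi>" "\<And>i. p i \<phi> \<le> U'"
      "U' < cos \<phi>" for \<phi> L' U'
  proof -
    have "L' \<le> U'" using that(4)[of 1] that(5)[of 1] by linarith
    then have "aperture_ratio (cos \<theta>) L U \<le> aperture_ratio (cos \<phi>) L' U'"
      using that by (intro min) (force intro: order_trans[OF that(5)])+
    then show ?thesis
      using \<open>L < cos \<theta>\<close> \<open>U < cos \<theta>\<close> \<open>L' \<le> U'\<close> that(6) by (simp add: aperture_ratio_le_iff)
  qed
  \<comment> \<open>Compare with the same tilt and \<open>L\<close>, but with \<open>U\<close>
    lowered to the largest slope.\<close>
  obtain j where j: "p j \<theta> = U"
  proof -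
    define M where "M = Max (range (\<lambda>i. p i \<theta>))"
    have M: "p i \<theta> \<le> M" for i by (auto simp: M_def)
    have "M \<in> range (\<lambda>i. p i \<theta>)" unfolding M_def by (rule Max_in) auto
    then obtain j where "p j \<theta> = M" by auto
    then have "M \<le> U" using LU(2)[of j] by simp
    have "(cos \<theta> - M) / (cos \<theta> - L) \<le> (cos \<theta> - U) / (cos \<theta> - L)"
      using \<theta> LU M \<open>M \<le> U\<close> \<open>U < cos \<theta>\<close> by (intro minU) auto
    then have "U \<le> M" using \<open>L < cos \<theta>\<close> by (simp add: divide_le_cancel)
    then show ?thesis using that \<open>p j \<theta> = M\<close> \<open>M \<le> U\<close> by auto
  qed
  \<comment> \<open>Likewise with \<open>U\<close> kept and \<open>L\<close> raised to the smallest
    slope.\<close>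
  obtain k where k: "p k \<theta> = L"
  proof -
    define M where "M = Min (range (\<lambda>i. p i \<theta>))"
    have M: "M \<le> p i \<theta>" for i by (auto simp: M_def)
    have "M \<in> range (\<lambda>i. p i \<theta>)" unfolding M_def by (rule Min_in) auto
    then obtain k where "p k \<theta> = M" by auto
    then have "L \<le> M" "M < cos \<theta>" using LU(1,2)[of k] \<open>U < cos \<theta>\<close> by auto
    have "(cos \<theta> - U) / (cos \<theta> - M) \<le> (cos \<theta> - U) / (cos \<theta> - L)"
      using \<theta> LU M \<open>U < cos \<theta>\<close> by (intro minU) auto
    then have "M \<le> L"
      using \<open>L < cos \<theta>\<close> \<open>M < cos \<theta>\<close> \<open>U < cos \<theta>\<close> by (simp add: divide_simps)
    then show ?thesis using that \<open>p k \<theta> = M\<close> \<open>L \<le> M\<close> by auto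
  qed
  show ?thesis
  proof (rule ccontr)
    assume "\<not> ?thesis"
    then have ik: "p k \<theta> < p i \<theta>" and ij: "p i \<theta> < p j \<theta>"
      using LU(1,2)[of i] j k by (auto simp: less_le)
    have dist: "i \<noteq> j" "i \<noteq> k" "j \<noteq> k" using ik ij by auto
    have univ: "m = i \<or> m = j \<or> m = k" for m
    proof -
      have "card {i, j, k} = card (UNIV :: 3 set)" using dist by simp
      then have "{i, j, k} = UNIV" by (intro card_subset_eq) auto
      then show ?thesis by auto
    qed
    have less: "\<forall>\<^sub>F \<phi> in nhds \<theta>. g \<phi> < h \<phi>"
      if "isCont g \<theta>" "isCont h \<theta>" "g \<theta> < h \<theta>" for g h :: "real \<Rightarrow> real"
      using order_tendstoD(1)[OF tendsto_diff, of h "h \<theta>" "nhds \<theta>" g "g \<theta>" 0] that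
      by (simp add: isCont_def tendsto_at_iff_tendsto_nhds)
    \<comment> \<open>The strict order of the three slopes persists nearby, so
      \<open>p k \<phi>\<close> and \<open>p j \<phi>\<close> serve as competing bounds
      there.\<close>
    have ev: "\<forall>\<^sub>F \<phi> in nhds \<theta>. p k \<phi> < p i \<phi>" "\<forall>\<^sub>F \<phi> in nhds \<theta>. p i \<phi> < p j \<phi>"
      "\<forall>\<^sub>F \<phi> in nhds \<theta>. p j \<phi> < cos \<phi>"
      using ik ij j \<open>U < cos \<theta>\<close> by (auto intro!: less cont)
    have "\<forall>\<^sub>F \<phi> in nhds \<theta>. \<phi> \<in> {- (pi / 2)<..<pi / 2} - {0}"
      using \<theta> by (intro eventually_nhds_in_open open_delete) auto
    with ev have "\<forall>\<^sub>F \<phi> in nhds \<theta>.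
        (cos \<phi> - p j \<phi>) / (cos \<phi> - p k \<phi>) \<le> (cos \<theta> - U) / (cos \<theta> - L)"
    proof eventually_elim
      case (elim \<phi>)
      have "p k \<phi> \<le> p m \<phi>" "p m \<phi> \<le> p j \<phi>" for m
        using univ[of m] elim by auto
      then show ?case using elim by (intro minU) auto
    qed
    then have "\<forall>\<^sub>F \<phi> in nhds \<theta>.
        (cos \<phi> * z j - sin \<phi> * y j - f) / (cos \<phi> * z k - sin \<phi> * y k - f)
        \<le> (cos \<theta> * z j - sin \<theta> * y j - f) / (cos \<theta> * z k - sin \<theta> * y k - f)"
    proof eventually_elim
      case (elim \<phi>)
      \<comment> \<open>The factor \<open>z k / z j\<close> is positive and independent of the tilt,
        so the local maximum passes to the quotient of distances.\<close>
      have q: "(cos \<phi> - p j \<phi>) / (cos \<phi> - p k \<phi>) =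
          (cos \<phi> * z j - sin \<phi> * y j - f) / (cos \<phi> * z k - sin \<phi> * y k - f) * (z k / z j)" for \<phi>
        using z0[of j] z0[of k] by (simp add: p_def cos_minus_tilt_slope)
      from elim have "(cos \<phi> - p j \<phi>) / (cos \<phi> - p k \<phi>) \<le> (cos \<theta> - p j \<theta>) / (cos \<theta> - p k \<theta>)"
        by (simp add: j k)
      then show ?case
        unfolding q using z0[of j] z0[of k] by (subst (asm) mult_le_cancel_right) auto
    qed
    moreover have "cos \<theta> * z k - sin \<theta> * y k - f \<noteq> 0"
      using cos_minus_tilt_slope[of "z k" \<theta> f "y k"] z0[of k] k \<open>L < cos \<theta>\<close>
      by (auto simp: p_def)
    ultimately show False
      using not_local_max_focal_distance_ratio[OF cross[OF dist(3)], of \<theta>] by blast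
  qed
qed

section \<open>Translation between planes and slopes\<close>

lemma inner_limit_normal:
  assumes "P $ 1 = 0" "P $ 3 \<noteq> 0" "sin \<phi> \<noteq> 0"
  shows "(P - hinge_point f \<phi>) \<bullet> limit_normal a k =
    (sin \<phi> * a $ k - tilt_slope f (P $ 2) (P $ 3) \<phi>) * (P $ 3 / sin \<phi>)"
  using assms
  by (simp add: inner_vec_def sum_3 hinge_point_def limit_normal_def tilt_slope_def field_simps)

lemma inner_lens_normal_ge_iff:
  assumes "P $ 1 = 0" "P $ 3 > 0"
  shows "P \<bullet> lens_normal \<phi> \<ge> f \<longleftrightarrow> tilt_slope f (P $ 2) (P $ 3) \<phi> \<le> cos \<phi>"
  using assms
  by (auto simp: inner_vec_def sum_3 lens_normal_def tilt_slope_def field_simps)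

text \<open>The sign of \<open>\<phi>\<close> determines which of the two limiting planes is the upper one.\<close>

definition lower_slope :: "real^2 \<Rightarrow> real \<Rightarrow> real" where
  "lower_slope a \<phi> = sin \<phi> * a $ (if \<phi> > 0 then 2 else 1)"

definition upper_slope :: "real^2 \<Rightarrow> real \<Rightarrow> real" where
  "upper_slope a \<phi> = sin \<phi> * a $ (if \<phi> > 0 then 1 else 2)"

lemma sin_tilt_sign:
  assumes "- (pi / 2) < \<phi>" "\<phi> < pi / 2" "\<phi> \<noteq> 0"
  shows "if \<phi> > 0 then sin \<phi> > 0 else sin \<phi> < 0"
  using assms sin_gt_zero[of \<phi>] sin_gt_zero[of "- \<phi>"] pi_gt_zero by auto

text \<open>The factor \<open>P $ 3 / sin \<phi>\<close> from \<open>inner_limit_normal\<close>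
  reverses both plane inequalities for negative tilt; the index swap in the two slopes
  compensates.\<close>

lemma admissible_iff:
  assumes "\<And>i. X i $ 1 = 0" "\<And>i. X i $ 3 > 0"
  shows "admissible f X a \<phi> \<longleftrightarrow> - (pi / 2) < \<phi> \<and> \<phi> < pi / 2 \<and> \<phi> \<noteq> 0 \<and>
    2 * cos \<phi> - upper_slope a \<phi> - lower_slope a \<phi> \<noteq> 0 \<and>
    (\<forall>i. lower_slope a \<phi> \<le> tilt_slope f (X i $ 2) (X i $ 3) \<phi> \<and>
      tilt_slope f (X i $ 2) (X i $ 3) \<phi> \<le> upper_slope a \<phi> \<and>
      tilt_slope f (X i $ 2) (X i $ 3) \<phi> \<le> cos \<phi>)"
proof (cases "- (pi / 2) < \<phi> \<and> \<phi> < pi / 2 \<and> \<phi> \<noteq> 0")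
  case True
  then have sgn: "if \<phi> > 0 then sin \<phi> > 0 else sin \<phi> < 0" by (intro sin_tilt_sign) auto
  then have "sin \<phi> \<noteq> 0" by (auto split: if_splits)
  have z: "X i $ 3 \<noteq> 0" for i using assms(2)[of i] by simp
  have denom: "2 * cos \<phi> - (a $ 1 + a $ 2) * sin \<phi>
      = 2 * cos \<phi> - upper_slope a \<phi> - lower_slope a \<phi>"
    by (simp add: upper_slope_def lower_slope_def algebra_simps)
  have "(X i - hinge_point f \<phi>) \<bullet> limit_normal a 1 \<ge> 0 \<and>
      (X i - hinge_point f \<phi>) \<bullet> limit_normal a 2 \<le> 0 \<longleftrightarrow>
      lower_slope a \<phi> \<le> tilt_slope f (X i $ 2) (X i $ 3) \<phi> \<and>
      tilt_slope f (X i $ 2) (X i $ 3) \<phi> \<le> upper_slope a \<phi>" for i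
    using sgn assms(2)[of i]
    unfolding inner_limit_normal[OF assms(1) z \<open>sin \<phi> \<noteq> 0\<close>]
    by (auto simp: upper_slope_def lower_slope_def zero_le_mult_iff mult_le_0_iff
        zero_le_divide_iff divide_le_0_iff split: if_splits)
  then show ?thesis
    unfolding admissible_def denom using True inner_lens_normal_ge_iff[OF assms] by blast
next
  case False
  then show ?thesis by (auto simp: admissible_def)
qed

lemma f_number_eq_aperture_ratio:
  assumes "admissible f X a \<phi>" "\<And>i. X i $ 1 = 0" "\<And>i. X i $ 3 > 0"
  shows "f_number f c a \<phi> = f / c * aperture_ratio (cos \<phi>) (lower_slope a \<phi>) (upper_slope a \<phi>)"
proof -
  have "lower_slope a \<phi> \<le> upper_slope a \<phi>"
    using assms(1) admissible_iff[where X = X, OF assms(2,3)] by (meson order_trans)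
  then have "\<bar>(a $ 1 - a $ 2) * sin \<phi>\<bar> = upper_slope a \<phi> - lower_slope a \<phi>"
    unfolding abs_if by (auto simp: upper_slope_def lower_slope_def algebra_simps split: if_splits)
  moreover have "2 * cos \<phi> - (a $ 1 + a $ 2) * sin \<phi>
      = 2 * cos \<phi> - upper_slope a \<phi> - lower_slope a \<phi>"
    by (simp add: upper_slope_def lower_slope_def algebra_simps)
  ultimately show ?thesis
    unfolding f_number_def aperture_ratio_def abs_divide by metis
qed

text \<open>This makes every pair of bounds a legitimate competitor, so minimality over
  \<open>a\<close> becomes minimality over \<open>L\<close> and \<open>U\<close>.\<close>

lemma ex_lower_upper_slope:
  assumes "sin \<phi> \<noteq> 0"
  shows "\<exists>a. lower_slope a \<phi> = L \<and> upper_slope a \<phi> = U"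
proof (intro exI conjI)
  let ?a = "vector [if \<phi> > 0 then U / sin \<phi> else L / sin \<phi>,
    if \<phi> > 0 then L / sin \<phi> else U / sin \<phi>] :: real^2"
  show "lower_slope ?a \<phi> = L" "upper_slope ?a \<phi> = U"
    using assms by (auto simp: lower_slope_def upper_slope_def)
qed

lemma cross_square_greater:
  fixes P Q :: "real^3"
  assumes "P $ 1 = 0" "Q $ 1 = 0" "f > 0" "norm (cross3 P Q) / norm (P - Q) > f"
  shows "(P $ 2 * Q $ 3 - P $ 3 * Q $ 2)\<^sup>2 > f\<^sup>2 * ((P $ 2 - Q $ 2)\<^sup>2 + (P $ 3 - Q $ 3)\<^sup>2)"
proof -
  \<comment> \<open>For coinciding points the quotient would be 0, as division by zero yields 0,
    contrary to \<open>f > 0\<close>.\<close>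
  have "norm (P - Q) \<noteq> 0" using assms(3,4) by auto
  then have "f * norm (P - Q) < norm (cross3 P Q)"
    using assms(4) by (simp add: pos_less_divide_eq)
  then have "(f * norm (P - Q))\<^sup>2 < (norm (cross3 P Q))\<^sup>2"
    using assms(3) by (intro power_strict_mono) auto
  moreover have "(norm (P - Q))\<^sup>2 = (P $ 2 - Q $ 2)\<^sup>2 + (P $ 3 - Q $ 3)\<^sup>2"
    unfolding power2_norm_eq_inner
    using assms(1,2) by (simp add: inner_vec_def sum_3 power2_eq_square)
  moreover have "(norm (cross3 P Q))\<^sup>2 = (P $ 2 * Q $ 3 - P $ 3 * Q $ 2)\<^sup>2"
    unfolding power2_norm_eq_inner
    using assms(1,2) by (simp add: inner_vec_def sum_3 cross3_def power2_eq_square)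
  ultimately show ?thesis by (simp add: power_mult_distrib)
qed

theorem proposition2:
  fixes f c \<theta> :: real and a :: "real^2" and X :: "3 \<Rightarrow> real^3"
  assumes "f > 0" and "c > 0"
    and "\<not> collinear (range X)"
    and "\<And>i. X i $ 1 = 0"
    and "\<And>i. X i $ 3 > f"
    and "\<And>i j. i \<noteq> j \<Longrightarrow> norm (cross3 (X i) (X j)) / norm (X i - X j) > f"
    and "is_arg_min (\<lambda>(b, \<phi>). f_number f c b \<phi>) (\<lambda>(b, \<phi>). admissible f X b \<phi>) (a, \<theta>)"
  shows "\<forall>i. X i \<in> SFP f a \<theta> 1 \<or> X i \<in> SFP f a \<theta> 2"
proof
  fix i
  have z: "X i $ 3 > 0" for i using assms(5)[of i] \<open>f > 0\<close> by simp
  note adm_iff = admissible_iff[OF assms(4) z]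
  have adm: "admissible f X a \<theta>"
    and min: "\<And>b \<phi>. admissible f X b \<phi> \<Longrightarrow> f_number f c a \<theta> \<le> f_number f c b \<phi>"
    using assms(7) by (auto simp: is_arg_min_linorder)
  note adm' = adm[unfolded adm_iff]
  from adm' have \<theta>: "- (pi / 2) < \<theta>" "\<theta> < pi / 2" "\<theta> \<noteq> 0" by auto
  have "tilt_slope f (X i $ 2) (X i $ 3) \<theta> = lower_slope a \<theta> \<or>
      tilt_slope f (X i $ 2) (X i $ 3) \<theta> = upper_slope a \<theta>"
  proof (rule minimal_aperture_ratio_contact[of f "\<lambda>i. X i $ 3" "\<lambda>i. X i $ 2"])
    fix \<phi> L U :: real
    assume \<phi>: "- (pi / 2) < \<phi>" "\<phi> < pi / 2" "\<phi> \<noteq> 0"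
      and LU: "\<And>i. L \<le> tilt_slope f (X i $ 2) (X i $ 3) \<phi>"
        "\<And>i. tilt_slope f (X i $ 2) (X i $ 3) \<phi> \<le> U"
        "\<And>i. tilt_slope f (X i $ 2) (X i $ 3) \<phi> \<le> cos \<phi>"
        "2 * cos \<phi> - U - L \<noteq> 0"
    have "sin \<phi> \<noteq> 0" using sin_tilt_sign[OF \<phi>] by (auto split: if_splits)
    then obtain b where b: "lower_slope b \<phi> = L" "upper_slope b \<phi> = U"
      using ex_lower_upper_slope by blast
    have "admissible f X b \<phi>" unfolding adm_iff b using \<phi> LU by blast
    \<comment> \<open>The common factor \<open>f / c\<close> is positive and cancels.\<close>
    with min[OF this] adm
    show "aperture_ratio (cos \<theta>) (lower_slope a \<theta>) (upper_slope a \<theta>)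
        \<le> aperture_ratio (cos \<phi>) L U"
      using \<open>f > 0\<close> \<open>c > 0\<close> b
      by (simp add: f_number_eq_aperture_ratio[OF _ assms(4) z] divide_le_cancel)
  next
    fix i j :: 3 assume "i \<noteq> j"
    then show "f\<^sup>2 * ((X i $ 2 - X j $ 2)\<^sup>2 + (X i $ 3 - X j $ 3)\<^sup>2)
        < (X i $ 2 * X j $ 3 - X i $ 3 * X j $ 2)\<^sup>2"
      using assms by (intro cross_square_greater) auto
  qed (use assms(1,5) adm' in auto)
  \<comment> \<open>Which plane is touched depends on the sign of the tilt, but only its existence
    matters.\<close>
  then have "\<exists>k. tilt_slope f (X i $ 2) (X i $ 3) \<theta> = sin \<theta> * a $ k"
    by (auto simp: lower_slope_def upper_slope_def)
  then obtain k where k: "tilt_slope f (X i $ 2) (X i $ 3) \<theta> = sin \<theta> * a $ k" by blast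
  have "sin \<theta> \<noteq> 0" using sin_tilt_sign[OF \<theta>] by (auto split: if_splits)
  then have "X i \<in> SFP f a \<theta> k"
    using assms(4)[of i] z[of i] k by (simp add: SFP_def inner_limit_normal)
  then show "X i \<in> SFP f a \<theta> 1 \<or> X i \<in> SFP f a \<theta> 2"
    using exhaust_2[of k] by auto
qed

end
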